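(* Let $(X, \tau)$ be a topological space and let $\mathcal{I}$ be an ideal on $\omega$. Assume that one of the following conditions holds: (i) $X$ is sequential and strongly Lindelöf, and $\mathcal{I}$ is a P-ideal; (ii) $X$ is first countable. Then $\tau = \tau(\mathcal{I})$.
   Context: $\omega$ denotes the set of positive integers. An ideal $\mathcal{I}$ on $\omega$ is a family of subsets of $\omega$ closed under finite unions and under taking subsets of its elements, different from the power set of $\omega$ and containing all singletons. $\mathcal{I}$ is a P-ideal if for every sequence $(A_n)$ of sets in $\mathcal{I}$ there exists $A \in \mathcal{I}$ such that $A_n \setminus A$ is finite for all $n$. For a sequence $x = (x_n)$ in $X$, $\Gamma_x(\mathcal{I})$ is the set of $\mathcal{I}$-cluster points of $x$, i.e. the set of all $\ell \in X$ such that $\{n : x_n \in U\} \notin \mathcal{I}$ for all neighborhoods $U$ of $\ell$. Define $$\tau(\mathcal{I}) := \left\{F^c : F \subseteq X,\ F = \bigcup_{x \in F^{\omega}} \Gamma_x(\mathcal{I})\right\},$$ where $F^c = X \setminus F$ and $F^\omega$ is the set of sequences with values in $F$ (the cluster points being taken in $(X,\tau)$). A topological space is strongly Lindelöf if every open subset of it is Lindelöf (equivalently, every subspace is Lindelöf). A topological space is sequential if every sequentially closed subset (i.e. a subset containing all limits of convergent sequences of its points) is closed. *)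

theory Defs
  imports "HOL-Analysis.Analysis"
begin

text \<open>Index set of ideals and sequences: the positive integers, so 0 is excluded.\<close>

definition omega :: "nat set" where
  "omega = {n. 0 < n}"

definition ideal_on_omega :: "nat set set \<Rightarrow> bool" where
  "ideal_on_omega I \<longleftrightarrow>
     I \<subseteq> Pow omega \<and> I \<noteq> Pow omega \<and>
     (\<forall>n\<in>omega. {n} \<in> I) \<and>
     (\<forall>A\<in>I. \<forall>B. B \<subseteq> A \<longrightarrow> B \<in> I) \<and>
     (\<forall>A\<in>I. \<forall>B\<in>I. A \<union> B \<in> I)"

definition P_ideal :: "nat set set \<Rightarrow> bool" where
  "P_ideal I \<longleftrightarrow> ideal_on_omega I \<and>
     (\<forall>A :: nat \<Rightarrow> nat set. (\<forall>n\<in>omega. A n \<in> I) \<longrightarrow> (\<exists>B\<in>I. \<forall>n\<in>omega. finite (A n - B)))"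

text \<open>A neighbourhood of a point is a subset of the space, not necessarily open,
  that contains the point in its interior.\<close>

definition cluster_points :: "'a topology \<Rightarrow> nat set set \<Rightarrow> (nat \<Rightarrow> 'a) \<Rightarrow> 'a set" where
  "cluster_points X I x =
     {l \<in> topspace X. \<forall>U. U \<subseteq> topspace X \<and> l \<in> X interior_of U \<longrightarrow> {n \<in> omega. x n \<in> U} \<notin> I}"

text \<open>The sequences with values in \<open>F\<close> are the elements of \<open>omega \<rightarrow>\<^sub>E F\<close>;
  extensionality only fixes the irrelevant value at 0.\<close>

definition ideal_open_sets :: "'a topology \<Rightarrow> nat set set \<Rightarrow> 'a set set" where
  "ideal_open_sets X I =
     {topspace X - F | F. F \<subseteq> topspace X \<and> F = (\<Union>x \<in> omega \<rightarrow>\<^sub>E F. cluster_points X I x)}"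

definition strongly_Lindelof_space :: "'a topology \<Rightarrow> bool" where
  "strongly_Lindelof_space X \<longleftrightarrow> (\<forall>U. openin X U \<longrightarrow> Lindelof_space (subtopology X U))"

text \<open>Sequences are indexed here by all of \<open>nat\<close>, as the library does; reindexing by the
  positive integers does not change the limits.\<close>

definition sequentially_closedin :: "'a topology \<Rightarrow> 'a set \<Rightarrow> bool" where
  "sequentially_closedin X F \<longleftrightarrow> F \<subseteq> topspace X \<and>
     (\<forall>(x :: nat \<Rightarrow> 'a) l. range x \<subseteq> F \<and> limitin X x l sequentially \<longrightarrow> l \<in> F)"

definition sequential_space :: "'a topology \<Rightarrow> bool" where
  "sequential_space X \<longleftrightarrow> (\<forall>F. sequentially_closedin X F \<longrightarrow> closedin X F)"

end

theory Submission
  imports Defs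
begin

text \<open>
  A set \<open>F\<close> is contained in \<open>\<Union>x \<in> F\<^sup>\<omega>. \<Gamma>\<^sub>x(I)\<close> for trivial reasons: each of its points
  is the \<open>I\<close>-cluster point of a constant sequence. Hence \<open>F\<close> has the fixed-point property
  that defines \<open>\<tau>(I)\<close> iff no \<open>I\<close>-cluster point of a sequence in \<open>F\<close> leaves \<open>F\<close>.

  A closed \<open>F\<close> has this property in every space, because a cluster point outside \<open>F\<close> would
  have the neighbourhood \<open>X - F\<close>, which the sequence visits on the empty set of indices, a
  member of \<open>I\<close>. So \<open>\<tau> \<subseteq> \<tau>(I)\<close>.

  Conversely, \<open>I\<close> contains all finite sets and is proper, so it contains no cofinite set, and
  ordinary limits are \<open>I\<close>-cluster points (\<open>limit_is_cluster_point\<close>). A fixed point \<open>F\<close> is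
  therefore sequentially closed, and it is closed as soon as the space is sequential. Both
  alternatives of the hypothesis provide this; a first countable space is sequential by
  \<open>first_countable_imp_sequential\<close>.
\<close>

section \<open>Ideals and cluster points\<close>

lemma finite_in_ideal:
  assumes I: "ideal_on_omega I" and "finite A" "A \<subseteq> omega"
  shows "A \<in> I"
  using assms(2,3)
proof (induction A rule: finite_induct)
  case empty
  have "{1} \<in> I"
    using I by (auto simp: ideal_on_omega_def omega_def)
  then show ?case
    using I by (auto simp: ideal_on_omega_def)
next
  case (insert a A)
  then have "{a} \<in> I" "A \<in> I"
    using I by (auto simp: ideal_on_omega_def)
  then have "{a} \<union> A \<in> I"
    using I unfolding ideal_on_omega_def by blast
  then show ?case
    by simp
qed

lemma omega_notin_ideal:
  assumes "ideal_on_omega I"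
  shows "omega \<notin> I"
  using assms unfolding ideal_on_omega_def by blast

lemma cofinite_notin_ideal:
  assumes I: "ideal_on_omega I" and "A \<subseteq> omega" "finite (omega - A)"
  shows "A \<notin> I"
proof
  assume "A \<in> I"
  moreover have "omega - A \<in> I"
    using finite_in_ideal[OF I] assms(3) by simp
  ultimately have "A \<union> (omega - A) \<in> I"
    using I unfolding ideal_on_omega_def by blast
  moreover have "A \<union> (omega - A) = omega"
    using assms(2) by blast
  ultimately show False
    using omega_notin_ideal[OF I] by simp
qed

text \<open>A convergent sequence visits each neighbourhood of its limit on a cofinite set of
  indices, and such a set is too large for \<open>I\<close>.\<close>

lemma limit_is_cluster_point:
  assumes I: "ideal_on_omega I" and lim: "limitin X x l sequentially"
  shows "l \<in> cluster_points X I x"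
  unfolding cluster_points_def
proof (intro CollectI conjI allI impI)
  show "l \<in> topspace X"
    using lim by (simp add: limitin_def)
next
  fix U
  assume "U \<subseteq> topspace X \<and> l \<in> X interior_of U"
  then have "\<forall>\<^sub>F n in sequentially. x n \<in> X interior_of U"
    using lim by (simp add: limitin_def)
  then have "\<forall>\<^sub>F n in sequentially. x n \<in> U"
    by (rule eventually_mono) (rule subsetD[OF interior_of_subset])
  then have "finite {n. x n \<notin> U}"
    unfolding cofinite_eq_sequentially[symmetric] eventually_cofinite .
  then have "finite (omega - {n \<in> omega. x n \<in> U})"
    by (rule rev_finite_subset) blast
  then show "{n \<in> omega. x n \<in> U} \<notin> I"
    by (intro cofinite_notin_ideal[OF I]) auto
qed

text \<open>This passes from sequences on all of \<open>nat\<close>, the ones that occur in limits, to the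
  extensional ones over which the fixed-point property ranges.\<close>

lemma cluster_points_restrict_omega:
  "cluster_points X I (restrict x omega) = cluster_points X I x"
proof -
  have "{n \<in> omega. restrict x omega n \<in> U} = {n \<in> omega. x n \<in> U}" for U
    by auto
  then show ?thesis
    by (simp add: cluster_points_def)
qed

lemma subset_Union_cluster_points:
  assumes I: "ideal_on_omega I" and "F \<subseteq> topspace X"
  shows "F \<subseteq> (\<Union>x \<in> omega \<rightarrow>\<^sub>E F. cluster_points X I x)"
proof
  fix l
  assume l: "l \<in> F"
  then have "limitin X (\<lambda>_. l) l sequentially"
    using assms(2) by (auto simp: limitin_def)
  then have "l \<in> cluster_points X I (restrict (\<lambda>_. l) omega)"
    unfolding cluster_points_restrict_omega by (rule limit_is_cluster_point[OF I])
  moreover have "restrict (\<lambda>_. l) omega \<in> omega \<rightarrow>\<^sub>E F"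
    using l by auto
  ultimately show "l \<in> (\<Union>x \<in> omega \<rightarrow>\<^sub>E F. cluster_points X I x)"
    by blast
qed

lemma cluster_points_subset_closed:
  assumes I: "ideal_on_omega I" and F: "closedin X F" and x: "x \<in> omega \<rightarrow>\<^sub>E F"
  shows "cluster_points X I x \<subseteq> F"
proof (rule subsetI, rule ccontr)
  fix l
  assume l: "l \<in> cluster_points X I x" and "l \<notin> F"
  have "openin X (topspace X - F)"
    using F by (simp add: closedin_def)
  then have "X interior_of (topspace X - F) = topspace X - F"
    by (rule interior_of_openin)
  then have "{n \<in> omega. x n \<in> topspace X - F} \<notin> I"
    using l \<open>l \<notin> F\<close> unfolding cluster_points_def by blast
  moreover have "{n \<in> omega. x n \<in> topspace X - F} = {}"
    using x by auto
  ultimately show False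
    using finite_in_ideal[OF I finite.emptyI empty_subsetI] by metis
qed

section \<open>First countable spaces are sequential\<close>

lemma first_countable_closure_limit:
  fixes X :: "'a topology"
  assumes fc: "first_countable X" and l: "l \<in> X closure_of F"
  obtains x :: "nat \<Rightarrow> 'a" where "range x \<subseteq> F" "limitin X x l sequentially"
proof -
  have lX: "l \<in> topspace X"
    using l by (simp add: in_closure_of)
  obtain \<B> where \<B>: "countable \<B>" "\<And>V. V \<in> \<B> \<Longrightarrow> openin X V"
    "\<And>U. openin X U \<Longrightarrow> l \<in> U \<Longrightarrow> \<exists>V\<in>\<B>. l \<in> V \<and> V \<subseteq> U"
    using fc lX unfolding first_countable_def by metis
  define \<C> where "\<C> = {V \<in> \<B>. l \<in> V}"
  have ctble: "countable \<C>"
    unfolding \<C>_def by (rule countable_subset[OF _ \<B>(1)]) blast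
  have ne: "\<C> \<noteq> {}"
    using \<B>(3)[OF openin_topspace lX] unfolding \<C>_def by blast
  define V where "V = from_nat_into \<C>"
  have V: "openin X (V n)" "l \<in> V n" for n
    using from_nat_into[OF ne, of n] \<B>(2) unfolding V_def \<C>_def by auto
  \<comment> \<open>Finite intersections turn the enumerated base at \<open>l\<close> into a decreasing one, so that
      a point chosen at stage \<open>n\<close> lies in all earlier members.\<close>
  have "\<exists>y. y \<in> F \<and> y \<in> (\<Inter>k\<le>n. V k)" for n
  proof -
    have "openin X (\<Inter>k\<in>{..n}. V k)"
      by (rule openin_INT2) (use V in auto)
    then show ?thesis
      using l V(2) unfolding in_closure_of by (metis INT_I)
  qed
  then obtain x where x: "\<And>n. x n \<in> F" "\<And>n. x n \<in> (\<Inter>k\<le>n. V k)"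
    by metis
  have "limitin X x l sequentially"
    unfolding limitin_def
  proof (intro conjI allI impI)
    fix U
    assume "openin X U \<and> l \<in> U"
    then obtain W where "W \<in> \<C>" "W \<subseteq> U"
      using \<B>(3) unfolding \<C>_def by blast
    then obtain k where k: "V k \<subseteq> U"
      using from_nat_into_surj[OF ctble] unfolding V_def by metis
    have "x n \<in> U" if "n \<ge> k" for n
      using x(2)[of n] that k by blast
    then show "\<forall>\<^sub>F n in sequentially. x n \<in> U"
      unfolding eventually_sequentially by blast
  qed (rule lX)
  with x(1) show thesis
    by (intro that) auto
qed

lemma first_countable_imp_sequential:
  fixes X :: "'a topology"
  assumes "first_countable X"
  shows "sequential_space X"
  unfolding sequential_space_def
proof (intro allI impI)
  fix F
  assume F: "sequentially_closedin X F"
  then have sub: "F \<subseteq> topspace X"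
    by (simp add: sequentially_closedin_def)
  have "X closure_of F \<subseteq> F"
  proof
    fix l
    assume "l \<in> X closure_of F"
    then obtain x :: "nat \<Rightarrow> 'a" where "range x \<subseteq> F" "limitin X x l sequentially"
      by (rule first_countable_closure_limit[OF assms])
    then show "l \<in> F"
      using F unfolding sequentially_closedin_def by blast
  qed
  then show "closedin X F"
    using sub closure_of_subset_eq by blast
qed

section \<open>Open sets recovered from cluster points\<close>

lemma sequential_imp_ideal_open_sets:
  assumes I: "ideal_on_omega I" and seq: "sequential_space X"
  shows "ideal_open_sets X I = {U. openin X U}"
proof (intro equalityI subsetI)
  fix U
  assume "U \<in> ideal_open_sets X I"
  then obtain F where U: "U = topspace X - F" and sub: "F \<subseteq> topspace X"
    and F: "F = (\<Union>x \<in> omega \<rightarrow>\<^sub>E F. cluster_points X I x)"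
    unfolding ideal_open_sets_def by blast
  have "l \<in> F" if "range x \<subseteq> F" "limitin X x l sequentially" for x l
  proof -
    have "l \<in> cluster_points X I (restrict x omega)"
      unfolding cluster_points_restrict_omega using I that(2) by (rule limit_is_cluster_point)
    moreover have "restrict x omega \<in> omega \<rightarrow>\<^sub>E F"
      using that(1) by auto
    ultimately show ?thesis
      by (subst F) blast
  qed
  then have "sequentially_closedin X F"
    using sub unfolding sequentially_closedin_def by blast
  then have "closedin X F"
    using seq by (simp add: sequential_space_def)
  then show "U \<in> {U. openin X U}"
    by (simp add: U closedin_def)
next
  fix U
  assume "U \<in> {U. openin X U}"
  then have U: "openin X U"
    by simp
  let ?F = "topspace X - U"
  have "closedin X ?F"
    using U by (simp add: openin_closedin_eq)
  then have "(\<Union>x \<in> omega \<rightarrow>\<^sub>E ?F. cluster_points X I x) \<subseteq> ?F"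
    using cluster_points_subset_closed[OF I] by blast
  then have "?F = (\<Union>x \<in> omega \<rightarrow>\<^sub>E ?F. cluster_points X I x)"
    using subset_Union_cluster_points[OF I, of ?F X] by blast
  moreover have "U = topspace X - ?F"
    using openin_subset[OF U] by blast
  ultimately show "U \<in> ideal_open_sets X I"
    unfolding ideal_open_sets_def by blast
qed

theorem theorem3p8:
  fixes X :: "'a topology" and I :: "nat set set"
  assumes "ideal_on_omega I"
    and "(sequential_space X \<and> strongly_Lindelof_space X \<and> P_ideal I) \<or> first_countable X"
  shows "{U. openin X U} = ideal_open_sets X I"
proof -
  have "sequential_space X"
    using assms(2) first_countable_imp_sequential by blast
  then show ?thesis
    using sequential_imp_ideal_open_sets[OF assms(1)] by blast
qed

end
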